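(* Consider the panel change point model $Y_{i,t}=\mu_i+\delta_i\mathcal{I}\{t>\tau\}+\sigma\varepsilon_{i,t}$, $1\le i\le N$, $1\le t\le T$, with $T$ fixed and error vectors satisfying the conditions in the context, and let $\{w(t)\}_{t=2}^T$ be a sequence of (nonzero real) weights. Suppose that $\tau\neq1$ and that: (i) the sequence $\left\{\frac{t}{w(t)}\left(1-\frac{r(t)}{t^2}\right)\right\}_{t=2}^T$ is strictly decreasing; (ii) there exist constants $L>0$ and $N_0\in\mathbb{N}$ such that $$L<\sigma^2\left[\frac{t}{w(t)}\left(1-\frac{r(t)}{t^2}\right)-\frac{\tau}{w(\tau)}\left(1-\frac{r(\tau)}{\tau^2}\right)\right]+\frac{\tau(t-\tau)}{t\,w(t)}\frac1N\sum_{i=1}^N\delta_i^2$$ for each $t=\tau+1,\ldots,T$ and each $N\ge N_0$; (iii) $\lim_{N\to\infty}\frac{1}{N^2}\sum_{i=1}^N\delta_i^2=0$; (iv) $\mathsf{E}\varepsilon_{1,t}^4<\infty$ for all $t\in\{1,\ldots,T\}$. Let $$\widehat{\tau}_N:=\arg\min_{t=2,\ldots,T}\frac{1}{w(t)}\sum_{i=1}^N\sum_{s=1}^t\left(Y_{i,s}-\overline{Y}_{i,t}\right)^2,\qquad \overline{Y}_{i,t}=\frac1t\sum_{s=1}^tY_{i,s}.$$ Then $\lim_{N\to\infty}\mathsf{P}[\widehat{\tau}_N=\tau]=1$.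
   Context: Panel change point model: $Y_{i,t}=\mu_i+\delta_i\mathcal{I}\{t>\tau\}+\sigma\varepsilon_{i,t}$, $1\le i\le N$, $1\le t\le T$, where $\sigma>0$ is an unknown parameter, $\mu_i,\delta_i$ are (non-random) real numbers (the $\delta_i$ may depend on $N$), $\tau\in\{1,\ldots,T\}$ is the common change point ($\tau=T$ means no change), and $T$ is fixed (not depending on $N$). Conditions on the errors: the vectors $[\varepsilon_{i,1},\ldots,\varepsilon_{i,T}]^{\top}$, defined on a probability space $(\Omega,\mathcal{F},\mathsf{P})$, are iid for $i=1,\ldots,N$, with $\mathsf{E}\varepsilon_{i,t}=0$, $\mathsf{Var}\,\varepsilon_{i,t}=1$, and autocorrelation function $\rho_t=\mathsf{Corr}(\varepsilon_{i,s},\varepsilon_{i,s+t})=\mathsf{Cov}(\varepsilon_{i,s},\varepsilon_{i,s+t})$ for all $s\in\{1,\ldots,T-t\}$, not depending on $s$ (with $\rho_{-t}=\rho_t$). Cumulative autocorrelation function: $r(t)=\mathsf{Var}\sum_{s=1}^t\varepsilon_{i,s}=\sum_{|s|<t}(t-|s|)\rho_s$. *)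

theory Defs
  imports "HOL-Probability.Probability"
begin

definition covariance :: "'a measure \<Rightarrow> ('a \<Rightarrow> real) \<Rightarrow> ('a \<Rightarrow> real) \<Rightarrow> real" where
  "covariance M X Y =
     (\<integral>\<omega>. (X \<omega> - (\<integral>\<omega>'. X \<omega>' \<partial>M)) * (Y \<omega> - (\<integral>\<omega>'. Y \<omega>' \<partial>M)) \<partial>M)"

definition correlation :: "'a measure \<Rightarrow> ('a \<Rightarrow> real) \<Rightarrow> ('a \<Rightarrow> real) \<Rightarrow> real" where
  "correlation M X Y =
     covariance M X Y / sqrt (prob_space.variance M X * prob_space.variance M Y)"

text \<open>
  Panels are indexed by \<open>i \<ge> 1\<close> and time points by \<open>t \<in> {1..T}\<close>; values at other indices
  are irrelevant. The autocorrelation \<open>\<rho>\<close> takes a nonnegative lag; the convention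
  \<open>\<rho>\<^sub>-\<^sub>t = \<rho>\<^sub>t\<close> is expressed by writing \<open>\<rho> (nat \<bar>d\<bar>)\<close> for an integer lag \<open>d\<close>.
\<close>

locale panel_errors = prob_space M for M :: "'a measure" +
  fixes T :: nat
    and \<epsilon> :: "nat \<Rightarrow> nat \<Rightarrow> 'a \<Rightarrow> real"
    and \<rho> :: "nat \<Rightarrow> real"
  assumes errors_indep:
      "indep_vars (\<lambda>_. \<Pi>\<^sub>M t\<in>{1..T}. borel) (\<lambda>i \<omega>. \<lambda>t\<in>{1..T}. \<epsilon> i t \<omega>) {1..}"
    and errors_ident:
      "\<And>i. i \<ge> 1 \<Longrightarrow>
         distr M (\<Pi>\<^sub>M t\<in>{1..T}. borel) (\<lambda>\<omega>. \<lambda>t\<in>{1..T}. \<epsilon> i t \<omega>)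
       = distr M (\<Pi>\<^sub>M t\<in>{1..T}. borel) (\<lambda>\<omega>. \<lambda>t\<in>{1..T}. \<epsilon> 1 t \<omega>)"
    and errors_square_integrable:
      "\<And>i t. i \<ge> 1 \<Longrightarrow> t \<in> {1..T} \<Longrightarrow> integrable M (\<lambda>\<omega>. (\<epsilon> i t \<omega>)\<^sup>2)"
    and errors_mean: "\<And>i t. i \<ge> 1 \<Longrightarrow> t \<in> {1..T} \<Longrightarrow> expectation (\<epsilon> i t) = 0"
    and errors_variance: "\<And>i t. i \<ge> 1 \<Longrightarrow> t \<in> {1..T} \<Longrightarrow> variance (\<epsilon> i t) = 1"
    and errors_autocorrelation:
      "\<And>i t s. i \<ge> 1 \<Longrightarrow> t < T \<Longrightarrow> s \<in> {1..T - t} \<Longrightarrow>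
         correlation M (\<epsilon> i s) (\<epsilon> i (s + t)) = \<rho> t"

text \<open>
  \<open>Y N i t\<close> is the observation of panel \<open>i\<close> at time \<open>t\<close> when there are \<open>N\<close> panels; it depends
  on \<open>N\<close> because the jumps \<open>\<delta> N i\<close> may.
\<close>

locale panel_change_point = panel_errors M T \<epsilon> \<rho>
  for M :: "'a measure" and T \<epsilon> \<rho> +
  fixes \<tau> :: nat
    and \<sigma> :: real
    and \<mu> :: "nat \<Rightarrow> real"
    and \<delta> :: "nat \<Rightarrow> nat \<Rightarrow> real"
    and Y :: "nat \<Rightarrow> nat \<Rightarrow> nat \<Rightarrow> 'a \<Rightarrow> real"
  assumes change_point: "\<tau> \<in> {1..T}"
    and scale_pos: "\<sigma> > 0"
    and observations:
      "\<And>N i t \<omega>. i \<in> {1..N} \<Longrightarrow> t \<in> {1..T} \<Longrightarrow> \<omega> \<in> space M \<Longrightarrow>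
         Y N i t \<omega> = \<mu> i + \<delta> N i * of_bool (t > \<tau>) + \<sigma> * \<epsilon> i t \<omega>"

text \<open>
  The errors are identically distributed over the panels, so the cumulative autocorrelation
  may be read off the first one.
\<close>

definition cumulative_autocorrelation ::
  "'a measure \<Rightarrow> (nat \<Rightarrow> nat \<Rightarrow> 'a \<Rightarrow> real) \<Rightarrow> nat \<Rightarrow> real" where
  "cumulative_autocorrelation M \<epsilon> t = prob_space.variance M (\<lambda>\<omega>. \<Sum>s=1..t. \<epsilon> 1 s \<omega>)"

definition panel_mean :: "(nat \<Rightarrow> nat \<Rightarrow> 'a \<Rightarrow> real) \<Rightarrow> nat \<Rightarrow> nat \<Rightarrow> 'a \<Rightarrow> real" where
  "panel_mean y i t \<omega> = (\<Sum>s=1..t. y i s \<omega>) / real t"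

definition change_point_criterion ::
  "(nat \<Rightarrow> real) \<Rightarrow> nat \<Rightarrow> (nat \<Rightarrow> nat \<Rightarrow> 'a \<Rightarrow> real) \<Rightarrow> 'a \<Rightarrow> nat \<Rightarrow> real" where
  "change_point_criterion w N y \<omega> t =
     1 / w t * (\<Sum>i=1..N. \<Sum>s=1..t. (y i s \<omega> - panel_mean y i t \<omega>)\<^sup>2)"

context panel_errors
begin

lemma errors_measurable:
  assumes "i \<ge> 1" "t \<in> {1..T}"
  shows "\<epsilon> i t \<in> borel_measurable M"
proof -
  have "(\<lambda>\<omega>. \<lambda>t\<in>{1..T}. \<epsilon> i t \<omega>) \<in> measurable M (\<Pi>\<^sub>M t\<in>{1..T}. borel)"
    using errors_indep assms unfolding indep_vars_def by auto
  from measurable_compose[OF this measurable_component_singleton[OF assms(2)]]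
  show ?thesis using assms by simp
qed

lemma errors_integrable:
  assumes "i \<ge> 1" "t \<in> {1..T}"
  shows "integrable M (\<epsilon> i t)"
  using square_integrable_imp_integrable[OF errors_measurable[OF assms]
      errors_square_integrable[OF assms]] .

lemma errors_product_integrable:
  assumes "i \<ge> 1" "s \<in> {1..T}" "t \<in> {1..T}"
  shows "integrable M (\<lambda>\<omega>. \<epsilon> i s \<omega> * \<epsilon> i t \<omega>)"
proof (rule Bochner_Integration.integrable_bound)
  show "integrable M (\<lambda>\<omega>. (\<epsilon> i s \<omega>)\<^sup>2 + (\<epsilon> i t \<omega>)\<^sup>2)"
    using assms errors_square_integrable by auto
  show "(\<lambda>\<omega>. \<epsilon> i s \<omega> * \<epsilon> i t \<omega>) \<in> borel_measurable M"
    using assms errors_measurable by auto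
  have "\<bar>a * b\<bar> \<le> a\<^sup>2 + b\<^sup>2" for a b :: real
  proof -
    have "2 * (\<bar>a\<bar> * \<bar>b\<bar>) \<le> \<bar>a\<bar>\<^sup>2 + \<bar>b\<bar>\<^sup>2"
      using sum_squares_bound[of "\<bar>a\<bar>" "\<bar>b\<bar>"] by (simp add: mult.assoc)
    then have "\<bar>a\<bar> * \<bar>b\<bar> \<le> \<bar>a\<bar>\<^sup>2 + \<bar>b\<bar>\<^sup>2"
      using mult_nonneg_nonneg[of "\<bar>a\<bar>" "\<bar>b\<bar>"] by linarith
    then show ?thesis by (simp add: abs_mult)
  qed
  then show "AE \<omega> in M. norm (\<epsilon> i s \<omega> * \<epsilon> i t \<omega>) \<le> norm ((\<epsilon> i s \<omega>)\<^sup>2 + (\<epsilon> i t \<omega>)\<^sup>2)"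
    by auto
qed

lemma autocorrelation_eq_covariance:
  assumes "i \<ge> 1" "t < T" "s \<in> {1..T - t}"
  shows "\<rho> t = covariance M (\<epsilon> i s) (\<epsilon> i (s + t))"
proof -
  have "s \<in> {1..T}" "s + t \<in> {1..T}" using assms by auto
  then show ?thesis
    using errors_autocorrelation[OF assms] errors_variance[OF assms(1)]
    by (simp add: correlation_def)
qed

lemma expectation_errors_product:
  assumes "i \<ge> 1" "t < T" "s \<in> {1..T - t}"
  shows "expectation (\<lambda>\<omega>. \<epsilon> i s \<omega> * \<epsilon> i (s + t) \<omega>) = \<rho> t"
proof -
  have "s \<in> {1..T}" "s + t \<in> {1..T}" using assms by auto
  then show ?thesis
    using autocorrelation_eq_covariance[OF assms] errors_mean[OF assms(1)]
    by (simp add: covariance_def)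
qed

lemma variance_partial_sum:
  assumes i: "i \<ge> 1" and "t \<le> T"
  shows "variance (\<lambda>\<omega>. \<Sum>s=1..t. \<epsilon> i s \<omega>)
       = (\<Sum>d\<in>{-int t<..<int t}. real_of_int (int t - \<bar>d\<bar>) * \<rho> (nat \<bar>d\<bar>))"
proof -
  have mean0: "expectation (\<lambda>\<omega>. \<Sum>s=1..t. \<epsilon> i s \<omega>) = 0" if "t \<le> T" for t
    using that i errors_mean errors_integrable by (subst Bochner_Integration.integral_sum) auto
  have "expectation (\<lambda>\<omega>. (\<Sum>s=1..t. \<epsilon> i s \<omega>)\<^sup>2)
       = (\<Sum>d\<in>{-int t<..<int t}. real_of_int (int t - \<bar>d\<bar>) * \<rho> (nat \<bar>d\<bar>))"
    using \<open>t \<le> T\<close>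
  proof (induction t)
    case 0
    then show ?case by simp
  next
    case (Suc t)
    let ?S = "\<lambda>\<omega>. \<Sum>s=1..t. \<epsilon> i s \<omega>"
    have prod_int: "integrable M (\<lambda>\<omega>. \<epsilon> i s \<omega> * \<epsilon> i u \<omega>)"
      if "s \<in> {1..Suc t}" "u \<in> {1..Suc t}" for s u
      using errors_product_integrable[OF i, of s u] that Suc.prems by auto
    have int1: "integrable M (\<lambda>\<omega>. (?S \<omega>)\<^sup>2)"
      unfolding power2_eq_square sum_product
      by (intro Bochner_Integration.integrable_sum prod_int) auto
    have int2: "integrable M (\<lambda>\<omega>. \<Sum>s=1..t. \<epsilon> i s \<omega> * \<epsilon> i (Suc t) \<omega>)"
      by (intro Bochner_Integration.integrable_sum prod_int) auto
    have int3: "integrable M (\<lambda>\<omega>. \<epsilon> i (Suc t) \<omega> * \<epsilon> i (Suc t) \<omega>)"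
      by (intro prod_int) auto
    have cross: "expectation (\<lambda>\<omega>. \<Sum>s=1..t. \<epsilon> i s \<omega> * \<epsilon> i (Suc t) \<omega>) = (\<Sum>d=1..t. \<rho> d)"
    proof -
      have "expectation (\<lambda>\<omega>. \<Sum>s=1..t. \<epsilon> i s \<omega> * \<epsilon> i (Suc t) \<omega>)
          = (\<Sum>s=1..t. expectation (\<lambda>\<omega>. \<epsilon> i s \<omega> * \<epsilon> i (Suc t) \<omega>))"
        by (intro Bochner_Integration.integral_sum prod_int) auto
      also have "\<dots> = (\<Sum>s=1..t. \<rho> (Suc t - s))"
      proof (intro sum.cong refl)
        fix s assume s: "s \<in> {1..t}"
        then show "expectation (\<lambda>\<omega>. \<epsilon> i s \<omega> * \<epsilon> i (Suc t) \<omega>) = \<rho> (Suc t - s)"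
          using expectation_errors_product[OF i, of "Suc t - s" s] Suc.prems by auto
      qed
      also have "\<dots> = (\<Sum>d=1..t. \<rho> d)"
        by (rule sum.reindex_bij_witness[where i = "\<lambda>d. Suc t - d" and j = "\<lambda>s. Suc t - s"]) auto
      finally show ?thesis .
    qed
    have diag: "expectation (\<lambda>\<omega>. \<epsilon> i (Suc t) \<omega> * \<epsilon> i (Suc t) \<omega>) = \<rho> 0"
      using expectation_errors_product[OF i, of 0 "Suc t"] Suc.prems by simp
    have "expectation (\<lambda>\<omega>. (\<Sum>s=1..Suc t. \<epsilon> i s \<omega>)\<^sup>2)
        = expectation (\<lambda>\<omega>. (?S \<omega>)\<^sup>2 + 2 * (\<Sum>s=1..t. \<epsilon> i s \<omega> * \<epsilon> i (Suc t) \<omega>)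
            + \<epsilon> i (Suc t) \<omega> * \<epsilon> i (Suc t) \<omega>)"
      by (simp add: power2_eq_square algebra_simps sum_distrib_left)
    also have "\<dots> = expectation (\<lambda>\<omega>. (?S \<omega>)\<^sup>2) + 2 * (\<Sum>d=1..t. \<rho> d) + \<rho> 0"
      using int1 int2 int3 cross diag by simp
    also have "expectation (\<lambda>\<omega>. (?S \<omega>)\<^sup>2)
        = (\<Sum>d\<in>{-int t<..<int t}. real_of_int (int t - \<bar>d\<bar>) * \<rho> (nat \<bar>d\<bar>))"
      using Suc by simp
    also have "\<dots> = (\<Sum>d\<in>{-int (Suc t)<..<int (Suc t)}. real_of_int (int t - \<bar>d\<bar>) * \<rho> (nat \<bar>d\<bar>))"
      by (rule sum.mono_neutral_left) auto
    finally have step: "expectation (\<lambda>\<omega>. (\<Sum>s=1..Suc t. \<epsilon> i s \<omega>)\<^sup>2)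
        = (\<Sum>d\<in>{-int (Suc t)<..<int (Suc t)}. real_of_int (int t - \<bar>d\<bar>) * \<rho> (nat \<bar>d\<bar>))
          + 2 * (\<Sum>d=1..t. \<rho> d) + \<rho> 0" .
    have total: "2 * (\<Sum>d=1..t. \<rho> d) + \<rho> 0 = (\<Sum>d\<in>{-int (Suc t)<..<int (Suc t)}. \<rho> (nat \<bar>d\<bar>))"
    proof -
      have split: "{-int (Suc t)<..<int (Suc t)} = (\<lambda>d. - int d) ` {1..t} \<union> int ` {1..t} \<union> {0}"
      proof (intro equalityI subsetI)
        fix d assume "d \<in> {-int (Suc t)<..<int (Suc t)}"
        then show "d \<in> (\<lambda>d. - int d) ` {1..t} \<union> int ` {1..t} \<union> {0}"
          by (cases d rule: int_cases2) (auto simp: image_iff intro!: bexI)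
      qed auto
      show ?thesis unfolding split
        by (subst sum.union_disjoint, force, force, force)+
          (simp add: sum.reindex inj_on_def)
    qed
    show ?case
      unfolding step add.assoc total sum.distrib[symmetric]
      by (rule sum.cong) (simp_all add: algebra_simps)
  qed
  then show ?thesis using mean0[OF \<open>t \<le> T\<close>] by simp
qed

lemma cumulative_autocorrelation_eq:
  assumes "t \<le> T"
  shows "cumulative_autocorrelation M \<epsilon> t
       = (\<Sum>d\<in>{-int t<..<int t}. real_of_int (int t - \<bar>d\<bar>) * \<rho> (nat \<bar>d\<bar>))"
  using variance_partial_sum[of 1 t] assms by (simp add: cumulative_autocorrelation_def)

end

end

theory Submission
  imports Defs
begin

text \<open>
  Divided by \<open>N\<close>, the criterion at a fixed \<open>t\<close> is close to a deterministic value: the sum of squared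
  deviations of panel \<open>i\<close> up to time \<open>t\<close> splits into a constant from the variance of the errors,
  \<open>\<sigma>\<^sup>2 * (t - r t / t)\<close>, a constant from the jump, \<open>\<delta>\<^sub>i\<^sup>2 * \<tau> * (t - \<tau>) / t\<close> (present only for
  \<open>t > \<tau>\<close>), and a centred noise term (\<open>criterion_decomposition\<close>). The average of the constants over the
  panels, divided by \<open>w t\<close>, has its minimum at \<open>\<tau>\<close>, and by a margin that stays bounded away from zero: for \<open>t < \<tau>\<close> both values come
  from the errors alone and condition (i) separates them, while for \<open>t > \<tau>\<close> the margin is exactly
  the quantity bounded below in condition (ii).

  It remains to see that the average of the noise terms vanishes in probability. They are functions
  of independent error vectors, so their second moments add up. One part of the noise is a centred
  sum of squares, whose second moment is finite because of the fourth moments (iv) and the same for all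
  panels; the other part is \<open>\<delta>\<^sub>i\<close> times a linear form in the errors. Hence the second moment of noise
  term \<open>i\<close> is at most \<open>a + b * \<delta>\<^sub>i\<^sup>2\<close>, that of the average is at most
  \<open>a / N + b * (\<Sum>i. \<delta>\<^sub>i\<^sup>2) / N\<^sup>2\<close>, and this tends to zero by (iii)
  (\<open>panel_noise_negligible\<close>). There are only finitely many \<open>t\<close>, so with probability tending to one
  every deviation is less than half of the margin, and then the minimiser is \<open>\<tau>\<close>
  (\<open>argmin_consistent\<close>).
\<close>

section \<open>Sums of squared deviations\<close>

definition sample_mean :: "nat \<Rightarrow> (nat \<Rightarrow> real) \<Rightarrow> real" where
  "sample_mean t x = (\<Sum>s=1..t. x s) / real t"

definition sum_sq_dev :: "nat \<Rightarrow> (nat \<Rightarrow> real) \<Rightarrow> real" where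
  "sum_sq_dev t x = (\<Sum>s=1..t. (x s - sample_mean t x)\<^sup>2)"

definition codeviation :: "nat \<Rightarrow> (nat \<Rightarrow> real) \<Rightarrow> (nat \<Rightarrow> real) \<Rightarrow> real" where
  "codeviation t x y = (\<Sum>s=1..t. (x s - sample_mean t x) * y s)"

lemma sum_deviations_eq_0: "(\<Sum>s=1..t. x s - sample_mean t x) = 0"
  by (cases "t = 0") (simp_all add: sample_mean_def sum_subtractf)

lemma sum_sq_dev_eq: "sum_sq_dev t x = (\<Sum>s=1..t. (x s)\<^sup>2) - (\<Sum>s=1..t. x s)\<^sup>2 / real t"
proof (cases "t = 0")
  case False
  have "sum_sq_dev t x = (\<Sum>s=1..t. (x s)\<^sup>2 - 2 * sample_mean t x * x s + (sample_mean t x)\<^sup>2)"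
    unfolding sum_sq_dev_def by (simp add: power2_diff algebra_simps)
  also have "\<dots> = (\<Sum>s=1..t. (x s)\<^sup>2) - 2 * sample_mean t x * (\<Sum>s=1..t. x s)
      + real t * (sample_mean t x)\<^sup>2"
    by (simp add: sum.distrib sum_subtractf sum_distrib_left)
  also have "\<dots> = (\<Sum>s=1..t. (x s)\<^sup>2) - (\<Sum>s=1..t. x s)\<^sup>2 / real t"
    using False by (simp add: sample_mean_def power2_eq_square field_simps)
  finally show ?thesis .
qed (simp add: sum_sq_dev_def)

text \<open>The deviations of \<open>x\<close> sum to zero, so replacing \<open>y\<close> by its own deviations does not change
  \<open>codeviation t x y\<close>: it is the bilinear form that belongs to the quadratic form \<open>sum_sq_dev t\<close>,
  and the constant \<open>m\<close> disappears.\<close>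

lemma sum_sq_dev_affine:
  "sum_sq_dev t (\<lambda>s. m + k * x s + c * y s)
     = k\<^sup>2 * sum_sq_dev t x + 2 * k * c * codeviation t x y + c\<^sup>2 * sum_sq_dev t y"
proof (cases "t = 0")
  case False
  let ?a = "\<lambda>s. x s - sample_mean t x" and ?b = "\<lambda>s. y s - sample_mean t y"
  have mean: "sample_mean t (\<lambda>s. m + k * x s + c * y s)
      = m + k * sample_mean t x + c * sample_mean t y"
    using False by (simp add: sample_mean_def sum.distrib sum_distrib_left field_simps)
  have "(\<Sum>s=1..t. ?a s * ?b s) = codeviation t x y - (\<Sum>s=1..t. ?a s) * sample_mean t y"
    unfolding codeviation_def sum_distrib_right sum_subtractf[symmetric]
    by (simp add: algebra_simps)
  then have cross: "(\<Sum>s=1..t. ?a s * ?b s) = codeviation t x y"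
    unfolding sum_deviations_eq_0 by simp
  have "sum_sq_dev t (\<lambda>s. m + k * x s + c * y s)
      = (\<Sum>s=1..t. k\<^sup>2 * (?a s)\<^sup>2 + 2 * k * c * (?a s * ?b s) + c\<^sup>2 * (?b s)\<^sup>2)"
    unfolding sum_sq_dev_def mean
    by (intro sum.cong refl) (simp add: power2_eq_square algebra_simps)
  also have "\<dots> = k\<^sup>2 * sum_sq_dev t x + 2 * k * c * codeviation t x y + c\<^sup>2 * sum_sq_dev t y"
    unfolding sum.distrib sum_distrib_left[symmetric] cross sum_sq_dev_def ..
  finally show ?thesis .
qed (simp add: sum_sq_dev_def codeviation_def)

lemma sum_of_bool_greater:
  "(\<Sum>s=1..t. of_bool (s > k) :: real) = real (t - k)"
proof -
  have "{1..t} \<inter> {s. k < s} = {k<..t}" by auto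
  then show ?thesis by (simp add: of_bool_def sum.If_cases)
qed

lemma sum_sq_dev_step:
  "sum_sq_dev t (\<lambda>s. of_bool (s > k)) = (if t \<le> k then 0 else real k * (real t - real k) / real t)"
proof -
  have "(\<Sum>s=1..t. (of_bool (s > k) :: real)\<^sup>2) = (\<Sum>s=1..t. of_bool (s > k))"
    by (intro sum.cong) auto
  then have "sum_sq_dev t (\<lambda>s. of_bool (s > k)) = real (t - k) - (real (t - k))\<^sup>2 / real t"
    by (simp only: sum_sq_dev_eq sum_of_bool_greater)
  then show ?thesis
    by (cases "t \<le> k") (simp_all add: power2_eq_square of_nat_diff field_simps)
qed

lemma sum_sq_dev_nonneg: "0 \<le> sum_sq_dev t x"
  unfolding sum_sq_dev_def by (intro sum_nonneg) simp

text \<open>Turns finite fourth moments of the entries into a finite second moment of the sum of squared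
  deviations.\<close>

lemma sum_sq_dev_power2_le: "(sum_sq_dev t x)\<^sup>2 \<le> real t * (\<Sum>s=1..t. x s ^ 4)"
proof -
  have "sum_sq_dev t x \<le> (\<Sum>s=1..t. (x s)\<^sup>2)"
    by (simp add: sum_sq_dev_eq)
  then have "(sum_sq_dev t x)\<^sup>2 \<le> (\<Sum>s=1..t. (x s)\<^sup>2)\<^sup>2"
    using sum_sq_dev_nonneg by (rule power_mono)
  also have "\<dots> \<le> (\<Sum>s=1..t. ((x s)\<^sup>2)\<^sup>2) * card {1..t}"
    by (rule sum_squared_le_sum_of_squares)
  finally show ?thesis by (simp add: mult.commute)
qed

lemma sum_sq_dev_restrict:
  "t \<le> n \<Longrightarrow> sum_sq_dev t (restrict x {1..n}) = sum_sq_dev t x"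
  unfolding sum_sq_dev_eq by simp

lemma codeviation_restrict:
  "t \<le> n \<Longrightarrow> codeviation t d (restrict x {1..n}) = codeviation t d x"
  unfolding codeviation_def by simp

lemma measurable_sum_sq_dev:
  assumes "t \<le> n"
  shows "sum_sq_dev t \<in> borel_measurable (\<Pi>\<^sub>M s\<in>{1..n}. borel)"
proof -
  have "(\<lambda>x. (\<Sum>s=1..t. (x s)\<^sup>2) - (\<Sum>s=1..t. x s)\<^sup>2 / real t)
      \<in> borel_measurable (\<Pi>\<^sub>M s\<in>{1..n}. borel)"
    using assms by (intro borel_measurable_diff borel_measurable_divide borel_measurable_sum
        borel_measurable_power borel_measurable_const measurable_component_singleton) auto
  then show ?thesis by (simp add: sum_sq_dev_eq[abs_def])
qed

lemma measurable_codeviation: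
  assumes "t \<le> n"
  shows "codeviation t d \<in> borel_measurable (\<Pi>\<^sub>M s\<in>{1..n}. borel)"
  unfolding codeviation_def[abs_def]
  using assms by (intro borel_measurable_sum borel_measurable_times borel_measurable_const
      measurable_component_singleton) auto

section \<open>A weak law and consistency of minimisers\<close>

context prob_space
begin

text \<open>Independent centred variables are orthogonal in the space of square-integrable functions,
  so this is the theorem of Pythagoras.\<close>

lemma second_moment_sum_indep:
  fixes U :: "'i \<Rightarrow> 'a \<Rightarrow> real"
  assumes fin: "finite I"
    and indep: "indep_vars (\<lambda>_. borel) U I"
    and sq: "\<And>i. i \<in> I \<Longrightarrow> integrable M (\<lambda>\<omega>. (U i \<omega>)\<^sup>2)"
    and mean: "\<And>i. i \<in> I \<Longrightarrow> expectation (U i) = 0"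
  shows "integrable M (\<lambda>\<omega>. (\<Sum>i\<in>I. U i \<omega>)\<^sup>2)"
    and "expectation (\<lambda>\<omega>. (\<Sum>i\<in>I. U i \<omega>)\<^sup>2) = (\<Sum>i\<in>I. expectation (\<lambda>\<omega>. (U i \<omega>)\<^sup>2))"
proof -
  have meas: "U i \<in> borel_measurable M" if "i \<in> I" for i
    using indep that by (auto simp: indep_vars_def)
  have int: "integrable M (U i)" if "i \<in> I" for i
    using square_integrable_imp_integrable[OF meas sq] that by auto
  have prod: "integrable M (\<lambda>\<omega>. U i \<omega> * U j \<omega>)
      \<and> expectation (\<lambda>\<omega>. U i \<omega> * U j \<omega>) = (if i = j then expectation (\<lambda>\<omega>. (U i \<omega>)\<^sup>2) else 0)"
    if "i \<in> I" "j \<in> I" for i j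
  proof (cases "i = j")
    case True
    then show ?thesis using sq[OF that(1)] by (simp add: power2_eq_square)
  next
    case False
    have pair: "indep_vars (\<lambda>_. borel) U {i, j}"
      using indep_vars_subset[OF indep] that by auto
    have "integrable M (U k)" if "k \<in> {i, j}" for k
      using int that \<open>i \<in> I\<close> \<open>j \<in> I\<close> by auto
    from indep_vars_integrable[OF _ pair this] indep_vars_lebesgue_integral[OF _ pair this]
    show ?thesis using False mean[OF that(1)] by simp
  qed
  have expand: "(\<Sum>i\<in>I. U i \<omega>)\<^sup>2 = (\<Sum>i\<in>I. \<Sum>j\<in>I. U i \<omega> * U j \<omega>)" for \<omega>
    by (simp add: power2_eq_square sum_product)
  show "integrable M (\<lambda>\<omega>. (\<Sum>i\<in>I. U i \<omega>)\<^sup>2)"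
    unfolding expand using prod by (intro Bochner_Integration.integrable_sum) auto
  have "expectation (\<lambda>\<omega>. (\<Sum>i\<in>I. U i \<omega>)\<^sup>2) = (\<Sum>i\<in>I. \<Sum>j\<in>I. expectation (\<lambda>\<omega>. U i \<omega> * U j \<omega>))"
    unfolding expand using prod
    by (subst Bochner_Integration.integral_sum, force)+ simp
  also have "\<dots> = (\<Sum>i\<in>I. \<Sum>j\<in>I. if i = j then expectation (\<lambda>\<omega>. (U i \<omega>)\<^sup>2) else 0)"
    using prod by (intro sum.cong refl) auto
  also have "\<dots> = (\<Sum>i\<in>I. expectation (\<lambda>\<omega>. (U i \<omega>)\<^sup>2))"
    using fin by (intro sum.cong refl) simp
  finally show "expectation (\<lambda>\<omega>. (\<Sum>i\<in>I. U i \<omega>)\<^sup>2) = (\<Sum>i\<in>I. expectation (\<lambda>\<omega>. (U i \<omega>)\<^sup>2))" .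
qed

text \<open>Chebyshev's inequality. The law of a summand may change with \<open>N\<close>, as it must for jumps that
  depend on the number of panels.\<close>

lemma weak_law_triangular_array:
  fixes U :: "nat \<Rightarrow> nat \<Rightarrow> 'a \<Rightarrow> real"
  assumes indep: "\<And>N. indep_vars (\<lambda>_. borel) (U N) {1..N}"
    and sq: "\<And>N i. i \<in> {1..N} \<Longrightarrow> integrable M (\<lambda>\<omega>. (U N i \<omega>)\<^sup>2)"
    and mean: "\<And>N i. i \<in> {1..N} \<Longrightarrow> expectation (U N i) = 0"
    and small: "(\<lambda>N. (\<Sum>i=1..N. expectation (\<lambda>\<omega>. (U N i \<omega>)\<^sup>2)) / (real N)\<^sup>2) \<longlonglongrightarrow> 0"
    and c: "c > 0"
  shows "(\<lambda>N. \<P>(\<omega> in M. \<bar>\<Sum>i=1..N. U N i \<omega>\<bar> \<ge> c * real N)) \<longlonglongrightarrow> 0"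
proof (rule tendsto_sandwich[OF _ _ tendsto_const])
  let ?V = "\<lambda>N. \<Sum>i=1..N. expectation (\<lambda>\<omega>. (U N i \<omega>)\<^sup>2)"
  show "\<forall>\<^sub>F N in sequentially. \<P>(\<omega> in M. \<bar>\<Sum>i=1..N. U N i \<omega>\<bar> \<ge> c * real N)
      \<le> ?V N / (real N)\<^sup>2 / c\<^sup>2"
    using eventually_gt_at_top[of 0]
  proof eventually_elim
    case (elim N)
    have "(\<lambda>\<omega>. \<Sum>i=1..N. U N i \<omega>) \<in> borel_measurable M"
      using indep[of N] by (intro borel_measurable_sum) (auto simp: indep_vars_def)
    from second_moment_method[OF this second_moment_sum_indep(1)[OF _ indep sq mean], of "c * real N"]
    show ?case
      using second_moment_sum_indep(2)[OF _ indep sq mean] elim c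
      by (simp add: power_mult_distrib mult.commute)
  qed
  have "(\<lambda>N. ?V N / (real N)\<^sup>2 / c\<^sup>2) \<longlonglongrightarrow> 0 / c\<^sup>2"
    using small c by (intro tendsto_divide tendsto_const) auto
  then show "(\<lambda>N. ?V N / (real N)\<^sup>2 / c\<^sup>2) \<longlonglongrightarrow> 0" by simp
qed simp

text \<open>A minimiser other than \<open>a\<close> forces the random criterion to reverse a gap of size \<open>2 * c\<close>,
  hence to deviate from its deterministic counterpart by at least \<open>c\<close> at one of two points.\<close>

lemma argmin_consistent:
  fixes Q :: "nat \<Rightarrow> 'a \<Rightarrow> 'b \<Rightarrow> real" and q :: "nat \<Rightarrow> 'b \<Rightarrow> real" and h :: "nat \<Rightarrow> 'a \<Rightarrow> 'b"
  assumes fin: "finite A" and a: "a \<in> A" and c: "c > 0"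
    and h_meas: "\<And>N. N \<ge> 1 \<Longrightarrow> h N \<in> measurable M (count_space UNIV)"
    and h_min: "\<And>N \<omega>. N \<ge> 1 \<Longrightarrow> \<omega> \<in> space M \<Longrightarrow> is_arg_min (Q N \<omega>) (\<lambda>x. x \<in> A) (h N \<omega>)"
    and Q_meas: "\<And>N x. x \<in> A \<Longrightarrow> (\<lambda>\<omega>. Q N \<omega> x) \<in> borel_measurable M"
    and gap: "\<And>x. x \<in> A - {a} \<Longrightarrow> \<forall>\<^sub>F N in sequentially. q N a + 2 * c \<le> q N x"
    and conv: "\<And>x. x \<in> A \<Longrightarrow> (\<lambda>N. \<P>(\<omega> in M. \<bar>Q N \<omega> x - q N x\<bar> \<ge> c)) \<longlonglongrightarrow> 0"
  shows "(\<lambda>N. \<P>(\<omega> in M. h N \<omega> = a)) \<longlonglongrightarrow> 1"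
proof -
  let ?B = "\<lambda>N x. {\<omega> \<in> space M. \<bar>Q N \<omega> x - q N x\<bar> \<ge> c}"
  have B_meas: "?B N x \<in> events" if "x \<in> A" for N x
    using Q_meas[OF that, of N] by measurable
  have lower: "\<forall>\<^sub>F N in sequentially. 1 - (\<Sum>x\<in>A. prob (?B N x)) \<le> \<P>(\<omega> in M. h N \<omega> = a)"
  proof -
    have "\<forall>\<^sub>F N in sequentially. \<forall>x\<in>A - {a}. q N a + 2 * c \<le> q N x"
      using fin gap by (intro eventually_ball_finite) auto
    then show ?thesis
      using eventually_ge_at_top[of 1]
    proof eventually_elim
      case (elim N)
      have E: "{\<omega> \<in> space M. h N \<omega> = a} \<in> events"
        using measurable_sets[OF h_meas[OF elim(2)], of "{a}"]
        by (simp add: vimage_def Int_def conj_commute)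
      have "space M - {\<omega> \<in> space M. h N \<omega> = a} \<subseteq> (\<Union>x\<in>A. ?B N x)"
      proof
        fix \<omega> assume \<omega>: "\<omega> \<in> space M - {\<omega> \<in> space M. h N \<omega> = a}"
        define x where "x = h N \<omega>"
        have "x \<in> A - {a}" "Q N \<omega> x \<le> Q N \<omega> a"
          using h_min[OF elim(2), of \<omega>] \<omega> a by (auto simp: is_arg_min_def x_def not_less)
        moreover from this have "q N a + 2 * c \<le> q N x" using elim(1) by blast
        ultimately have "\<bar>Q N \<omega> x - q N x\<bar> \<ge> c \<or> \<bar>Q N \<omega> a - q N a\<bar> \<ge> c" by linarith
        then show "\<omega> \<in> (\<Union>x\<in>A. ?B N x)" using \<omega> a \<open>x \<in> A - {a}\<close> by auto
      qed
      then have "prob (space M - {\<omega> \<in> space M. h N \<omega> = a}) \<le> prob (\<Union>x\<in>A. ?B N x)"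
        using fin B_meas by (intro finite_measure_mono) auto
      also have "\<dots> \<le> (\<Sum>x\<in>A. prob (?B N x))"
        using fin B_meas by (intro finite_measure_subadditive_finite) auto
      finally show ?case using prob_compl[OF E] by simp
    qed
  qed
  have "(\<lambda>N. 1 - (\<Sum>x\<in>A. prob (?B N x))) \<longlonglongrightarrow> 1 - (\<Sum>x\<in>A. 0)"
    using conv by (intro tendsto_diff tendsto_const tendsto_sum)
  then have lim: "(\<lambda>N. 1 - (\<Sum>x\<in>A. prob (?B N x))) \<longlonglongrightarrow> 1" by simp
  show ?thesis
    by (rule tendsto_sandwich[OF lower _ lim tendsto_const]) simp
qed

end

section \<open>Moments of the panel errors\<close>

context panel_errors
begin

lemma error_vector_measurable:
  "i \<ge> 1 \<Longrightarrow> (\<lambda>\<omega>. \<lambda>t\<in>{1..T}. \<epsilon> i t \<omega>) \<in> measurable M (\<Pi>\<^sub>M t\<in>{1..T}. borel)"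
  using errors_indep unfolding indep_vars_def by auto

text \<open>Moments of functionals of a whole error vector do not depend on the panel; this makes the
  second moment bounds below uniform in \<open>i\<close>.\<close>

lemma error_functional_ident:
  fixes f :: "(nat \<Rightarrow> real) \<Rightarrow> real"
  assumes i: "i \<ge> 1" and f: "f \<in> borel_measurable (\<Pi>\<^sub>M t\<in>{1..T}. borel)"
  shows "integrable M (\<lambda>\<omega>. f (\<lambda>t\<in>{1..T}. \<epsilon> i t \<omega>)) \<longleftrightarrow> integrable M (\<lambda>\<omega>. f (\<lambda>t\<in>{1..T}. \<epsilon> 1 t \<omega>))"
    and "expectation (\<lambda>\<omega>. f (\<lambda>t\<in>{1..T}. \<epsilon> i t \<omega>)) = expectation (\<lambda>\<omega>. f (\<lambda>t\<in>{1..T}. \<epsilon> 1 t \<omega>))"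
  using integrable_distr_eq[OF error_vector_measurable f, of i]
    integrable_distr_eq[OF error_vector_measurable f, of 1]
    integral_distr[OF error_vector_measurable f, of i]
    integral_distr[OF error_vector_measurable f, of 1] errors_ident[OF i] i by simp_all

lemma expectation_errors_square:
  assumes "i \<ge> 1" "t \<in> {1..T}"
  shows "expectation (\<lambda>\<omega>. (\<epsilon> i t \<omega>)\<^sup>2) = 1"
  using errors_variance[OF assms] errors_mean[OF assms] by simp

lemma partial_sum_square:
  assumes i: "i \<ge> 1" and t: "t \<le> T"
  shows "integrable M (\<lambda>\<omega>. (\<Sum>s=1..t. \<epsilon> i s \<omega>)\<^sup>2)"
    and "expectation (\<lambda>\<omega>. (\<Sum>s=1..t. \<epsilon> i s \<omega>)\<^sup>2) = cumulative_autocorrelation M \<epsilon> t"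
proof -
  show "integrable M (\<lambda>\<omega>. (\<Sum>s=1..t. \<epsilon> i s \<omega>)\<^sup>2)"
    unfolding power2_eq_square sum_product using i t
    by (intro Bochner_Integration.integrable_sum errors_product_integrable) auto
  have "expectation (\<lambda>\<omega>. \<Sum>s=1..t. \<epsilon> i s \<omega>) = 0"
    using i t errors_mean errors_integrable by (subst Bochner_Integration.integral_sum) auto
  then show "expectation (\<lambda>\<omega>. (\<Sum>s=1..t. \<epsilon> i s \<omega>)\<^sup>2) = cumulative_autocorrelation M \<epsilon> t"
    using variance_partial_sum[OF i t] cumulative_autocorrelation_eq[OF t] by simp
qed

text \<open>The noise part of the mean criterion. Since \<open>t - r t / t = t * (1 - r t / t\<^sup>2)\<close>, dividing by
  \<open>w t\<close> gives the sequence whose monotonicity is assumed.\<close>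

lemma sum_sq_dev_errors:
  assumes i: "i \<ge> 1" and t: "t \<le> T"
  shows "integrable M (\<lambda>\<omega>. sum_sq_dev t (\<lambda>s. \<epsilon> i s \<omega>))"
    and "expectation (\<lambda>\<omega>. sum_sq_dev t (\<lambda>s. \<epsilon> i s \<omega>))
       = real t - cumulative_autocorrelation M \<epsilon> t / real t"
proof -
  have int: "integrable M (\<lambda>\<omega>. \<Sum>s=1..t. (\<epsilon> i s \<omega>)\<^sup>2)"
    using i t errors_square_integrable by (intro Bochner_Integration.integrable_sum) auto
  have "expectation (\<lambda>\<omega>. \<Sum>s=1..t. (\<epsilon> i s \<omega>)\<^sup>2) = real t"
    using i t errors_square_integrable expectation_errors_square
    by (subst Bochner_Integration.integral_sum) auto
  then show "expectation (\<lambda>\<omega>. sum_sq_dev t (\<lambda>s. \<epsilon> i s \<omega>))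
       = real t - cumulative_autocorrelation M \<epsilon> t / real t"
    unfolding sum_sq_dev_eq using int partial_sum_square[OF i t]
    by (subst Bochner_Integration.integral_diff) auto
  show "integrable M (\<lambda>\<omega>. sum_sq_dev t (\<lambda>s. \<epsilon> i s \<omega>))"
    unfolding sum_sq_dev_eq using int partial_sum_square(1)[OF i t] by simp
qed

lemma codeviation_errors:
  assumes i: "i \<ge> 1" and t: "t \<le> T"
  shows "integrable M (\<lambda>\<omega>. codeviation t d (\<lambda>s. \<epsilon> i s \<omega>))"
    and "expectation (\<lambda>\<omega>. codeviation t d (\<lambda>s. \<epsilon> i s \<omega>)) = 0"
    and "integrable M (\<lambda>\<omega>. (codeviation t d (\<lambda>s. \<epsilon> i s \<omega>))\<^sup>2)"
proof -
  show "integrable M (\<lambda>\<omega>. codeviation t d (\<lambda>s. \<epsilon> i s \<omega>))"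
    unfolding codeviation_def using i t errors_integrable
    by (intro Bochner_Integration.integrable_sum) auto
  show "expectation (\<lambda>\<omega>. codeviation t d (\<lambda>s. \<epsilon> i s \<omega>)) = 0"
    unfolding codeviation_def using i t errors_integrable errors_mean
    by (subst Bochner_Integration.integral_sum) auto
  have "integrable M (\<lambda>\<omega>. (d s - sample_mean t d) * (d u - sample_mean t d) * (\<epsilon> i s \<omega> * \<epsilon> i u \<omega>))"
    if "s \<in> {1..t}" "u \<in> {1..t}" for s u
    using that i t errors_product_integrable[OF i, of s u] by auto
  then show "integrable M (\<lambda>\<omega>. (codeviation t d (\<lambda>s. \<epsilon> i s \<omega>))\<^sup>2)"
    unfolding codeviation_def power2_eq_square sum_product
    by (intro Bochner_Integration.integrable_sum) (simp add: algebra_simps)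
qed

lemma sum_sq_dev_errors_square_integrable:
  assumes fourth: "\<And>s. s \<in> {1..T} \<Longrightarrow> integrable M (\<lambda>\<omega>. \<epsilon> 1 s \<omega> ^ 4)"
    and i: "i \<ge> 1" and t: "t \<le> T"
  shows "integrable M (\<lambda>\<omega>. (sum_sq_dev t (\<lambda>s. \<epsilon> i s \<omega>))\<^sup>2)"
proof -
  have "integrable M (\<lambda>\<omega>. (sum_sq_dev t (\<lambda>s. \<epsilon> 1 s \<omega>))\<^sup>2)"
  proof (rule Bochner_Integration.integrable_bound)
    show "integrable M (\<lambda>\<omega>. real t * (\<Sum>s=1..t. \<epsilon> 1 s \<omega> ^ 4))"
      using fourth t by (intro integrable_mult_right Bochner_Integration.integrable_sum) auto
    show "(\<lambda>\<omega>. (sum_sq_dev t (\<lambda>s. \<epsilon> 1 s \<omega>))\<^sup>2) \<in> borel_measurable M"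
      using sum_sq_dev_errors(1)[of 1 t] t by auto
    show "AE \<omega> in M. norm ((sum_sq_dev t (\<lambda>s. \<epsilon> 1 s \<omega>))\<^sup>2)
        \<le> norm (real t * (\<Sum>s=1..t. \<epsilon> 1 s \<omega> ^ 4))"
      using sum_sq_dev_power2_le by (simp add: order_trans[OF _ abs_ge_self])
  qed
  then show ?thesis
    using error_functional_ident(1)[OF i borel_measurable_power[OF measurable_sum_sq_dev[OF t]]]
    unfolding sum_sq_dev_restrict[OF t] by blast
qed


text \<open>The random part of the sum of squared deviations of \<open>m + k * d + c * x\<close>, for a fixed signal
  \<open>k * d\<close> and an error vector \<open>x\<close>, after subtraction of its mean.\<close>

definition panel_noise :: "nat \<Rightarrow> real \<Rightarrow> real \<Rightarrow> (nat \<Rightarrow> real) \<Rightarrow> (nat \<Rightarrow> real) \<Rightarrow> real" where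
  "panel_noise t k c d x = 2 * k * c * codeviation t d x
     + c\<^sup>2 * (sum_sq_dev t x - (real t - cumulative_autocorrelation M \<epsilon> t / real t))"

lemma panel_noise_restrict:
  "t \<le> T \<Longrightarrow> panel_noise t k c d (restrict x {1..T}) = panel_noise t k c d x"
  by (simp add: panel_noise_def sum_sq_dev_restrict codeviation_restrict del: One_nat_def)

lemma indep_panel_noise:
  assumes t: "t \<le> T" and I: "I \<subseteq> {1..}"
  shows "indep_vars (\<lambda>_. borel) (\<lambda>i \<omega>. panel_noise t (k i) c d (\<lambda>s. \<epsilon> i s \<omega>)) I"
proof -
  have "panel_noise t (k i) c d \<in> borel_measurable (\<Pi>\<^sub>M s\<in>{1..T}. borel)" for i
    unfolding panel_noise_def[abs_def]
    using measurable_sum_sq_dev[OF t] measurable_codeviation[OF t] by measurable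
  then have "indep_vars (\<lambda>_. borel)
      (\<lambda>i \<omega>. panel_noise t (k i) c d (\<lambda>s\<in>{1..T}. \<epsilon> i s \<omega>)) I"
    by (intro indep_vars_compose2[OF indep_vars_subset[OF errors_indep I]])
  then show ?thesis by (simp only: panel_noise_restrict[OF t])
qed

lemma panel_noise_mean:
  assumes i: "i \<ge> 1" and t: "t \<le> T"
  shows "expectation (\<lambda>\<omega>. panel_noise t k c d (\<lambda>s. \<epsilon> i s \<omega>)) = 0"
  using sum_sq_dev_errors[OF i t] codeviation_errors[OF i t]
  by (simp add: panel_noise_def prob_space)

text \<open>The bound is affine in \<open>k\<^sup>2\<close> because the jump size \<open>k\<close> enters the noise linearly. Its
  coefficients are the same for all panels, so it can be averaged over \<open>i\<close>.\<close>

lemma panel_noise_second_moment: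
  assumes fourth: "\<And>s. s \<in> {1..T} \<Longrightarrow> integrable M (\<lambda>\<omega>. \<epsilon> 1 s \<omega> ^ 4)" and t: "t \<le> T"
  shows "\<And>i k. i \<ge> 1 \<Longrightarrow> integrable M (\<lambda>\<omega>. (panel_noise t k c d (\<lambda>s. \<epsilon> i s \<omega>))\<^sup>2)"
    and "\<exists>a b. \<forall>i\<ge>1. \<forall>k. expectation (\<lambda>\<omega>. (panel_noise t k c d (\<lambda>s. \<epsilon> i s \<omega>))\<^sup>2) \<le> a + b * k\<^sup>2"
proof -
  define m where "m = real t - cumulative_autocorrelation M \<epsilon> t / real t"
  define X where "X i \<omega> = codeviation t d (\<lambda>s. \<epsilon> i s \<omega>)" for i \<omega>
  define S where "S i \<omega> = sum_sq_dev t (\<lambda>s. \<epsilon> i s \<omega>) - m" for i \<omega>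
  have noise: "panel_noise t k c d (\<lambda>s. \<epsilon> i s \<omega>) = 2 * k * c * X i \<omega> + c\<^sup>2 * S i \<omega>" for i k \<omega>
    by (simp add: panel_noise_def X_def S_def m_def)
  have X2: "integrable M (\<lambda>\<omega>. (X i \<omega>)\<^sup>2)" and X: "X i \<in> borel_measurable M" if "i \<ge> 1" for i
    using codeviation_errors(1,3)[OF that t, of d] by (auto simp: X_def[abs_def])
  have S2: "integrable M (\<lambda>\<omega>. (S i \<omega>)\<^sup>2)" and S: "S i \<in> borel_measurable M" if "i \<ge> 1" for i
  proof -
    have "(S i \<omega>)\<^sup>2 = (sum_sq_dev t (\<lambda>s. \<epsilon> i s \<omega>))\<^sup>2 - 2 * m * sum_sq_dev t (\<lambda>s. \<epsilon> i s \<omega>) + m\<^sup>2" for \<omega>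
      by (simp add: S_def power2_diff algebra_simps)
    then show "integrable M (\<lambda>\<omega>. (S i \<omega>)\<^sup>2)"
      using sum_sq_dev_errors_square_integrable[OF fourth that t] sum_sq_dev_errors(1)[OF that t]
      by simp
    show "S i \<in> borel_measurable M"
      using sum_sq_dev_errors(1)[OF that t] by (auto simp: S_def[abs_def])
  qed
  have le: "(2 * k * c * x + c\<^sup>2 * y)\<^sup>2 \<le> 2 * c ^ 4 * y\<^sup>2 + 8 * c\<^sup>2 * k\<^sup>2 * x\<^sup>2" for k x y :: real
  proof -
    have "0 \<le> (2 * k * c * x - c\<^sup>2 * y)\<^sup>2" by simp
    then show ?thesis by (simp add: power2_eq_square power4_eq_xxxx algebra_simps)
  qed
  show int: "integrable M (\<lambda>\<omega>. (panel_noise t k c d (\<lambda>s. \<epsilon> i s \<omega>))\<^sup>2)" if "i \<ge> 1" for i k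
  proof (rule Bochner_Integration.integrable_bound)
    show "integrable M (\<lambda>\<omega>. 2 * c ^ 4 * (S i \<omega>)\<^sup>2 + 8 * c\<^sup>2 * k\<^sup>2 * (X i \<omega>)\<^sup>2)"
      using X2[OF that] S2[OF that] by simp
    show "(\<lambda>\<omega>. (panel_noise t k c d (\<lambda>s. \<epsilon> i s \<omega>))\<^sup>2) \<in> borel_measurable M"
      unfolding noise using X[OF that] S[OF that] by measurable
    show "AE \<omega> in M. norm ((panel_noise t k c d (\<lambda>s. \<epsilon> i s \<omega>))\<^sup>2)
        \<le> norm (2 * c ^ 4 * (S i \<omega>)\<^sup>2 + 8 * c\<^sup>2 * k\<^sup>2 * (X i \<omega>)\<^sup>2)"
      unfolding noise using le by (simp add: order_trans[OF _ abs_ge_self])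
  qed
  have "expectation (\<lambda>\<omega>. (panel_noise t k c d (\<lambda>s. \<epsilon> i s \<omega>))\<^sup>2)
      \<le> 2 * c ^ 4 * expectation (\<lambda>\<omega>. (S 1 \<omega>)\<^sup>2) + 8 * c\<^sup>2 * expectation (\<lambda>\<omega>. (X 1 \<omega>)\<^sup>2) * k\<^sup>2"
    if i: "i \<ge> 1" for i k
  proof -
    have "expectation (\<lambda>\<omega>. (panel_noise t k c d (\<lambda>s. \<epsilon> i s \<omega>))\<^sup>2)
        \<le> expectation (\<lambda>\<omega>. 2 * c ^ 4 * (S i \<omega>)\<^sup>2 + 8 * c\<^sup>2 * k\<^sup>2 * (X i \<omega>)\<^sup>2)"
      using int[OF i] X2[OF i] S2[OF i] le unfolding noise by (intro integral_mono) auto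
    also have "\<dots> = 2 * c ^ 4 * expectation (\<lambda>\<omega>. (S i \<omega>)\<^sup>2) + 8 * c\<^sup>2 * expectation (\<lambda>\<omega>. (X i \<omega>)\<^sup>2) * k\<^sup>2"
      using X2[OF i] S2[OF i] by simp
    also have "expectation (\<lambda>\<omega>. (X i \<omega>)\<^sup>2) = expectation (\<lambda>\<omega>. (X 1 \<omega>)\<^sup>2)"
      using error_functional_ident(2)[OF i borel_measurable_power[OF measurable_codeviation[OF t]]]
      unfolding X_def codeviation_restrict[OF t] .
    also have "expectation (\<lambda>\<omega>. (S i \<omega>)\<^sup>2) = expectation (\<lambda>\<omega>. (S 1 \<omega>)\<^sup>2)"
      using error_functional_ident(2)[OF i borel_measurable_power[OF borel_measurable_diff[OF
            measurable_sum_sq_dev[OF t] borel_measurable_const]]]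
      unfolding S_def sum_sq_dev_restrict[OF t] .
    finally show ?thesis .
  qed
  then show "\<exists>a b. \<forall>i\<ge>1. \<forall>k. expectation (\<lambda>\<omega>. (panel_noise t k c d (\<lambda>s. \<epsilon> i s \<omega>))\<^sup>2) \<le> a + b * k\<^sup>2"
    by blast
qed

lemma panel_noise_negligible:
  fixes k :: "nat \<Rightarrow> nat \<Rightarrow> real"
  assumes fourth: "\<And>s. s \<in> {1..T} \<Longrightarrow> integrable M (\<lambda>\<omega>. \<epsilon> 1 s \<omega> ^ 4)" and t: "t \<le> T"
    and small: "(\<lambda>N. 1 / (real N)\<^sup>2 * (\<Sum>i=1..N. (k N i)\<^sup>2)) \<longlonglongrightarrow> 0" and e: "e > 0"
  shows "(\<lambda>N. \<P>(\<omega> in M. \<bar>\<Sum>i=1..N. panel_noise t (k N i) c d (\<lambda>s. \<epsilon> i s \<omega>)\<bar> \<ge> e * real N)) \<longlonglongrightarrow> 0"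
proof (rule weak_law_triangular_array[OF _ _ _ _ e])
  let ?V = "\<lambda>N i. expectation (\<lambda>\<omega>. (panel_noise t (k N i) c d (\<lambda>s. \<epsilon> i s \<omega>))\<^sup>2)"
  obtain a b where ab: "\<And>i k. i \<ge> 1 \<Longrightarrow>
      expectation (\<lambda>\<omega>. (panel_noise t k c d (\<lambda>s. \<epsilon> i s \<omega>))\<^sup>2) \<le> a + b * k\<^sup>2"
    using panel_noise_second_moment(2)[OF fourth t] by blast
  show "(\<lambda>N. (\<Sum>i=1..N. ?V N i) / (real N)\<^sup>2) \<longlonglongrightarrow> 0"
  proof (rule tendsto_sandwich[OF _ _ tendsto_const])
    show "\<forall>\<^sub>F N in sequentially. (\<Sum>i=1..N. ?V N i) / (real N)\<^sup>2
        \<le> a * (1 / real N) + b * (1 / (real N)\<^sup>2 * (\<Sum>i=1..N. (k N i)\<^sup>2))"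
    proof (rule always_eventually, rule allI)
      fix N
      have "(\<Sum>i=1..N. ?V N i) \<le> (\<Sum>i=1..N. a + b * (k N i)\<^sup>2)"
        using ab by (intro sum_mono) simp
      also have "\<dots> = a * real N + b * (\<Sum>i=1..N. (k N i)\<^sup>2)"
        by (simp add: sum.distrib sum_distrib_left)
      finally have "(\<Sum>i=1..N. ?V N i) / (real N)\<^sup>2
          \<le> (a * real N + b * (\<Sum>i=1..N. (k N i)\<^sup>2)) / (real N)\<^sup>2"
        by (rule divide_right_mono) simp
      also have "\<dots> = a * (1 / real N) + b * (1 / (real N)\<^sup>2 * (\<Sum>i=1..N. (k N i)\<^sup>2))"
        by (simp add: add_divide_distrib power2_eq_square)
      finally show "(\<Sum>i=1..N. ?V N i) / (real N)\<^sup>2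
          \<le> a * (1 / real N) + b * (1 / (real N)\<^sup>2 * (\<Sum>i=1..N. (k N i)\<^sup>2))" .
    qed
    have "(\<lambda>N. a * (1 / real N) + b * (1 / (real N)\<^sup>2 * (\<Sum>i=1..N. (k N i)\<^sup>2))) \<longlonglongrightarrow> a * 0 + b * 0"
      by (intro tendsto_add tendsto_mult tendsto_const small lim_1_over_n)
    then show "(\<lambda>N. a * (1 / real N) + b * (1 / (real N)\<^sup>2 * (\<Sum>i=1..N. (k N i)\<^sup>2))) \<longlonglongrightarrow> 0"
      by simp
  qed (simp add: sum_nonneg)
qed (use indep_panel_noise[OF t] panel_noise_mean[OF _ t] panel_noise_second_moment(1)[OF fourth t] in auto)

end

section \<open>The criterion\<close>

context panel_change_point
begin

lemma criterion_decomposition: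
  assumes t: "t \<le> T" and \<omega>: "\<omega> \<in> space M"
  shows "change_point_criterion w N (Y N) \<omega> t
    = 1 / w t * (real N * (\<sigma>\<^sup>2 * (real t - cumulative_autocorrelation M \<epsilon> t / real t))
        + sum_sq_dev t (\<lambda>s. of_bool (s > \<tau>)) * (\<Sum>i=1..N. (\<delta> N i)\<^sup>2)
        + (\<Sum>i=1..N. panel_noise t (\<delta> N i) \<sigma> (\<lambda>s. of_bool (s > \<tau>)) (\<lambda>s. \<epsilon> i s \<omega>)))"
proof -
  let ?d = "\<lambda>s. of_bool (s > \<tau>) :: real"
  let ?m = "real t - cumulative_autocorrelation M \<epsilon> t / real t"
  have "(\<Sum>s=1..t. (Y N i s \<omega> - panel_mean (Y N) i t \<omega>)\<^sup>2)
      = \<sigma>\<^sup>2 * ?m + sum_sq_dev t ?d * (\<delta> N i)\<^sup>2 + panel_noise t (\<delta> N i) \<sigma> ?d (\<lambda>s. \<epsilon> i s \<omega>)"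
    if i: "i \<in> {1..N}" for i
  proof -
    have Y: "Y N i s \<omega> = \<mu> i + \<delta> N i * ?d s + \<sigma> * \<epsilon> i s \<omega>" if "s \<in> {1..t}" for s
      using observations[OF i _ \<omega>, of s] that t by auto
    have "panel_mean (Y N) i t \<omega> = sample_mean t (\<lambda>s. \<mu> i + \<delta> N i * ?d s + \<sigma> * \<epsilon> i s \<omega>)"
      unfolding panel_mean_def sample_mean_def
      by (intro arg_cong2[where f="(/)"] sum.cong refl Y)
    then have "(\<Sum>s=1..t. (Y N i s \<omega> - panel_mean (Y N) i t \<omega>)\<^sup>2)
        = sum_sq_dev t (\<lambda>s. \<mu> i + \<delta> N i * ?d s + \<sigma> * \<epsilon> i s \<omega>)"
      unfolding sum_sq_dev_def by (intro sum.cong refl) (simp add: Y)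
    then show ?thesis
      unfolding sum_sq_dev_affine panel_noise_def by (simp add: algebra_simps)
  qed
  then have "(\<Sum>i=1..N. \<Sum>s=1..t. (Y N i s \<omega> - panel_mean (Y N) i t \<omega>)\<^sup>2)
      = (\<Sum>i=1..N. \<sigma>\<^sup>2 * ?m + sum_sq_dev t ?d * (\<delta> N i)\<^sup>2
          + panel_noise t (\<delta> N i) \<sigma> ?d (\<lambda>s. \<epsilon> i s \<omega>))"
    by (rule sum.cong[OF refl])
  then show ?thesis
    unfolding change_point_criterion_def by (simp add: sum.distrib sum_distrib_left)
qed

lemma criterion_measurable:
  assumes t: "t \<le> T"
  shows "(\<lambda>\<omega>. change_point_criterion w N (Y N) \<omega> t) \<in> borel_measurable M"
proof -
  have "(\<lambda>\<omega>. panel_noise t (\<delta> N i) \<sigma> d (\<lambda>s. \<epsilon> i s \<omega>)) \<in> borel_measurable M"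
    if "i \<in> {1..N}" for i d
    using indep_panel_noise[OF t order_refl, of "\<delta> N" \<sigma> d] that by (auto simp: indep_vars_def)
  then show ?thesis
    by (simp cong: measurable_cong_simp add: criterion_decomposition[OF t])
qed

definition mean_criterion :: "(nat \<Rightarrow> real) \<Rightarrow> nat \<Rightarrow> nat \<Rightarrow> real" where
  "mean_criterion w N t =
     1 / w t * (\<sigma>\<^sup>2 * (real t - cumulative_autocorrelation M \<epsilon> t / real t)
       + sum_sq_dev t (\<lambda>s. of_bool (s > \<tau>)) * (1 / real N * (\<Sum>i=1..N. (\<delta> N i)\<^sup>2)))"

text \<open>The difference of the two sides is the average of the noise terms divided by \<open>w t\<close>; the weight
  may be negative, so the threshold for the noise is scaled by its absolute value.\<close>

lemma criterion_convergence:
  assumes fourth: "\<And>s. s \<in> {1..T} \<Longrightarrow> integrable M (\<lambda>\<omega>. \<epsilon> 1 s \<omega> ^ 4)" and t: "t \<le> T"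
    and small: "(\<lambda>N. 1 / (real N)\<^sup>2 * (\<Sum>i=1..N. (\<delta> N i)\<^sup>2)) \<longlonglongrightarrow> 0"
    and e: "e > 0" and w: "w t \<noteq> 0"
  shows "(\<lambda>N. \<P>(\<omega> in M. \<bar>change_point_criterion w N (Y N) \<omega> t / real N
            - mean_criterion w N t\<bar> \<ge> e)) \<longlonglongrightarrow> 0"
proof -
  let ?d = "\<lambda>s. of_bool (s > \<tau>) :: real"
  let ?U = "\<lambda>N \<omega>. \<Sum>i=1..N. panel_noise t (\<delta> N i) \<sigma> ?d (\<lambda>s. \<epsilon> i s \<omega>)"
  have "(e \<le> \<bar>change_point_criterion w N (Y N) \<omega> t / real N - mean_criterion w N t\<bar>)
      = (e * \<bar>w t\<bar> * real N \<le> \<bar>?U N \<omega>\<bar>)" if "N \<ge> 1" "\<omega> \<in> space M" for N \<omega>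
  proof -
    have "change_point_criterion w N (Y N) \<omega> t / real N - mean_criterion w N t
        = ?U N \<omega> / (w t * real N)"
      unfolding criterion_decomposition[OF t that(2)] mean_criterion_def
      using that(1) w by (simp add: field_simps)
    then have "\<bar>change_point_criterion w N (Y N) \<omega> t / real N - mean_criterion w N t\<bar>
        = \<bar>?U N \<omega>\<bar> / (\<bar>w t\<bar> * real N)"
      by (simp only: abs_divide abs_mult abs_of_nat)
    then show ?thesis
      using that(1) w by (simp add: pos_le_divide_eq mult.assoc)
  qed
  then have "\<forall>\<^sub>F N in sequentially.
      \<P>(\<omega> in M. \<bar>?U N \<omega>\<bar> \<ge> e * \<bar>w t\<bar> * real N)
      = \<P>(\<omega> in M. \<bar>change_point_criterion w N (Y N) \<omega> t / real N - mean_criterion w N t\<bar> \<ge> e)"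
    by (intro eventually_mono[OF eventually_ge_at_top[of 1]] arg_cong[where f=prob] Collect_cong) auto
  moreover have "(\<lambda>N. \<P>(\<omega> in M. \<bar>?U N \<omega>\<bar> \<ge> e * \<bar>w t\<bar> * real N)) \<longlonglongrightarrow> 0"
    using e w by (intro panel_noise_negligible[OF fourth t small]) auto
  ultimately show ?thesis by (rule Lim_transform_eventually[rotated])
qed

end

theorem theorem3:
  fixes M :: "'a measure"
    and T \<tau> :: nat
    and \<sigma> :: real
    and \<mu> w \<rho> r :: "nat \<Rightarrow> real"
    and \<delta> :: "nat \<Rightarrow> nat \<Rightarrow> real"
    and \<epsilon> :: "nat \<Rightarrow> nat \<Rightarrow> 'a \<Rightarrow> real"
    and Y :: "nat \<Rightarrow> nat \<Rightarrow> nat \<Rightarrow> 'a \<Rightarrow> real"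
    and tauhat :: "nat \<Rightarrow> 'a \<Rightarrow> nat"
  assumes model: "panel_change_point M T \<epsilon> \<rho> \<tau> \<sigma> \<mu> \<delta> Y"
    and r_def: "r = cumulative_autocorrelation M \<epsilon>"
    and weights: "\<And>t. t \<in> {2..T} \<Longrightarrow> w t \<noteq> 0"
    and tau_not_1: "\<tau> \<noteq> 1"
    and i: "strict_antimono_on {2..T} (\<lambda>t. real t / w t * (1 - r t / (real t)\<^sup>2))"
    and ii: "\<exists>L>0. \<exists>N0::nat. \<forall>N\<ge>N0. \<forall>t\<in>{\<tau>+1..T}.
        L < \<sigma>\<^sup>2 * (real t / w t * (1 - r t / (real t)\<^sup>2)
                   - real \<tau> / w \<tau> * (1 - r \<tau> / (real \<tau>)\<^sup>2))
            + real \<tau> * (real t - real \<tau>) / (real t * w t) * (1 / real N) * (\<Sum>i=1..N. (\<delta> N i)\<^sup>2)"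
    and iii: "(\<lambda>N. 1 / (real N)\<^sup>2 * (\<Sum>i=1..N. (\<delta> N i)\<^sup>2)) \<longlonglongrightarrow> 0"
    and iv: "\<And>t. t \<in> {1..T} \<Longrightarrow> integrable M (\<lambda>\<omega>. (\<epsilon> 1 t \<omega>) ^ 4)"
    and tauhat_measurable: "\<And>N. N \<ge> 1 \<Longrightarrow> tauhat N \<in> measurable M (count_space UNIV)"
    and tauhat_argmin: "\<And>N \<omega>. N \<ge> 1 \<Longrightarrow> \<omega> \<in> space M \<Longrightarrow>
        is_arg_min (change_point_criterion w N (Y N) \<omega>) (\<lambda>t. t \<in> {2..T}) (tauhat N \<omega>)"
  shows "(\<lambda>N. \<P>(\<omega> in M. tauhat N \<omega> = \<tau>)) \<longlonglongrightarrow> 1"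
proof -
  interpret panel_change_point M T \<epsilon> \<rho> \<tau> \<sigma> \<mu> \<delta> Y by (rule model)
  have \<tau>: "\<tau> \<in> {2..T}" using change_point tau_not_1 by auto
  define g where "g t = real t / w t * (1 - r t / (real t)\<^sup>2)" for t
  obtain L N0 where L: "L > 0" and gap_L: "\<And>N t. N \<ge> N0 \<Longrightarrow> t \<in> {\<tau>+1..T} \<Longrightarrow>
      L < \<sigma>\<^sup>2 * (g t - g \<tau>)
        + real \<tau> * (real t - real \<tau>) / (real t * w t) * (1 / real N) * (\<Sum>i=1..N. (\<delta> N i)\<^sup>2)"
    using ii unfolding g_def by blast
  have g_gap: "\<sigma>\<^sup>2 * (g t - g \<tau>) > 0" if "t \<in> {2..<\<tau>}" for t
  proof -
    have "g \<tau> < g t"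
      using monotone_onD[OF i, of t \<tau>] that \<tau> by (simp add: g_def)
    then show ?thesis using scale_pos by simp
  qed
  \<comment> \<open>Half of the smallest margin, over all competitors of \<open>\<tau>\<close>: those before \<open>\<tau>\<close> have the margins
    in the image below, and \<open>L\<close> serves for all those after \<open>\<tau>\<close>.\<close>
  define c where "c = Min (insert L ((\<lambda>t. \<sigma>\<^sup>2 * (g t - g \<tau>)) ` {2..<\<tau>})) / 2"
  have c: "c > 0"
    using L g_gap unfolding c_def by (subst half_gt_zero_iff, subst Min_gr_iff) auto
  have c_L: "2 * c \<le> L" and c_g: "\<And>t. t \<in> {2..<\<tau>} \<Longrightarrow> 2 * c \<le> \<sigma>\<^sup>2 * (g t - g \<tau>)"
    unfolding c_def by (auto intro!: Min_le simp del: Min_insert)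
  have mean_le: "mean_criterion w N t = \<sigma>\<^sup>2 * g t" if "t \<in> {2..\<tau>}" for N t
    using that \<tau> weights[of t]
    by (simp add: mean_criterion_def sum_sq_dev_step g_def r_def power2_eq_square field_simps)
  have mean_gt: "mean_criterion w N t = \<sigma>\<^sup>2 * g t
      + real \<tau> * (real t - real \<tau>) / (real t * w t) * (1 / real N) * (\<Sum>i=1..N. (\<delta> N i)\<^sup>2)"
    if t: "t \<in> {\<tau>+1..T}" for N t
  proof -
    have "1 / w t * (real t - r t / real t) = g t"
    proof -
      have "real t * (1 - r t / (real t)\<^sup>2) = real t - r t / real t"
        using t by (simp add: power2_eq_square right_diff_distrib)
      then show ?thesis by (simp add: g_def)
    qed
    moreover have "mean_criterion w N t = \<sigma>\<^sup>2 * (1 / w t * (real t - r t / real t))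
      + real \<tau> * (real t - real \<tau>) / (real t * w t) * (1 / real N) * (\<Sum>i=1..N. (\<delta> N i)\<^sup>2)"
      using t by (simp add: mean_criterion_def sum_sq_dev_step r_def add_divide_distrib ac_simps)
    ultimately show ?thesis by simp
  qed
  show ?thesis
  proof (rule argmin_consistent[OF _ \<tau> c tauhat_measurable,
        where Q = "\<lambda>N \<omega> t. change_point_criterion w N (Y N) \<omega> t / real N" and q = "mean_criterion w"])
    show "is_arg_min (\<lambda>t. change_point_criterion w N (Y N) \<omega> t / real N)
        (\<lambda>t. t \<in> {2..T}) (tauhat N \<omega>)" if "N \<ge> 1" "\<omega> \<in> space M" for N \<omega>
      using tauhat_argmin[OF that] that(1) by (simp add: is_arg_min_def divide_less_cancel)
    show "(\<lambda>\<omega>. change_point_criterion w N (Y N) \<omega> t / real N) \<in> borel_measurable M"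
      if "t \<in> {2..T}" for N t
      using criterion_measurable[of t w N] that by auto
    show "\<forall>\<^sub>F N in sequentially. mean_criterion w N \<tau> + 2 * c \<le> mean_criterion w N t"
      if "t \<in> {2..T} - {\<tau>}" for t
    proof (cases "t < \<tau>")
      case True
      then show ?thesis
        using c_g[of t] that \<tau> by (simp add: mean_le algebra_simps)
    next
      case False
      then have t: "t \<in> {\<tau>+1..T}" using that by auto
      show ?thesis
        using eventually_ge_at_top[of N0]
      proof eventually_elim
        case (elim N)
        have "mean_criterion w N \<tau> = \<sigma>\<^sup>2 * g \<tau>" using mean_le \<tau> by simp
        then show ?case
          using gap_L[OF elim t] mean_gt[OF t, of N] c_L by (simp only: right_diff_distrib)
      qed
    qed
    show "(\<lambda>N. \<P>(\<omega> in M. c \<le> \<bar>change_point_criterion w N (Y N) \<omega> t / real N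
        - mean_criterion w N t\<bar>)) \<longlonglongrightarrow> 0" if "t \<in> {2..T}" for t
      using criterion_convergence[OF iv _ iii c] weights[OF that] that by simp
  qed simp_all
qed

end
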